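(* Let $H$ be a finite-dimensional quasitriangular bialgebra with universal R-matrix $\mathcal{R}$ and involution $\tau$, and let $S\in H\otimes H^\circledast$ be the universal S-matrix (canonical element). Let $\delta^l_{H^{op}},\tilde\delta^l_H\colon H^\circledast\to H\otimes H^\circledast$ be the left coactions (of the co-opposite bialgebra $H^{op}$ and of $H$, respectively) determined by $$(\mathrm{id}\otimes\delta^l_{H^{op}})(S)=\mathcal{R}_{12}S_{13}\mathcal{R}'_{12},\qquad(\mathrm{id}\otimes\tilde\delta^l_H)(S)=\mathcal{R}''_{12}S_{13}\mathcal{R}_{12}$$ in $H\otimes H\otimes H^\circledast$. Then $S$ intertwines these coactions: for all $a\in H^\circledast$, $$\delta^l_{H^{op}}(a)\,S=S\,\tilde\delta^l_H(a)\quad\text{in }H\otimes H^\circledast.$$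
   Context: All algebras are over $\mathbb{C}$; summation over tensor components is suppressed. A universal R-matrix is an invertible $\mathcal{R}=\mathcal{R}_1\otimes\mathcal{R}_2\in H\otimes H$ with $(\Delta\otimes\mathrm{id})(\mathcal{R})=\mathcal{R}_{13}\mathcal{R}_{23}$, $(\mathrm{id}\otimes\Delta)(\mathcal{R})=\mathcal{R}_{13}\mathcal{R}_{12}$ and $\mathcal{R}\Delta(h)=\Delta_{op}(h)\mathcal{R}$ for all $h\in H$, where $\Delta_{op}$ is the flipped coproduct. An involution $\tau\colon H\to H$ is a linear map with $\tau^2=\mathrm{id}$ that is a coalgebra map and an algebra anti-automorphism. Put $\mathcal{R}'=\tau(\mathcal{R}_1)\otimes\mathcal{R}_2$ and $\mathcal{R}''=\mathcal{R}_2\otimes\tau(\mathcal{R}_1)$. $H^*$ is the dual algebra (product $m$ dual to $\Delta$), an $H$-bimodule by $\langle h\triangleright a,x\rangle=\langle a,xh\rangle$, $\langle a\triangleleft h,x\rangle=\langle a,hx\rangle$. The RE dual $H^\circledast$ is the vector space $H^*$ with the associative product $\tilde m(a\otimes b)=m\bigl(\tau(\bar{\mathcal{R}}_1)\triangleright a\otimes b\triangleleft\bar{\mathcal{R}}_2\bigr)$, $\bar{\mathcal R}=\mathcal{R}^{-1}$. The universal S-matrix is $S=\sum_\mu e_\mu\otimes e^\mu\in H\otimes H^\circledast$, with $\{e_\mu\}$ a basis of $H$ and $\{e^\mu\}$ the dual basis of $H^*=H^\circledast$. A linear map $\delta\colon H^\circledast\to H\otimes H^\circledast$ is determined by $(\mathrm{id}\otimes\delta)(S)=\sum_\mu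 e_\mu\otimes\delta(e^\mu)\in H\otimes H\otimes H^\circledast$; subscripts denote positions of tensor factors (so $S_{13}$ has its $H$-component in position 1 and its $H^\circledast$-component in position 3). *)

theory Defs
  imports Complex_Main "HOL-Library.Poly_Mapping"
begin

section \<open>Complex vector spaces and algebras\<close>

class complex_vector = ab_group_add +
  fixes scaleC :: "complex \<Rightarrow> 'a \<Rightarrow> 'a"  (infixr \<open>*\<^sub>C\<close> 75)
  assumes scaleC_add_right: "c *\<^sub>C (x + y) = c *\<^sub>C x + c *\<^sub>C y"
    and scaleC_add_left: "(c + d) *\<^sub>C x = c *\<^sub>C x + d *\<^sub>C x"
    and scaleC_scaleC: "c *\<^sub>C (d *\<^sub>C x) = (c * d) *\<^sub>C x"
    and scaleC_one: "1 *\<^sub>C x = x"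

text \<open>\<open>ring_1\<close> includes \<open>0 \<noteq> 1\<close>; a bialgebra satisfies this because its counit maps \<open>1\<close> to \<open>1\<close>.\<close>

class complex_algebra_1 = complex_vector + ring_1 +
  assumes mult_scaleC_left: "(c *\<^sub>C x) * y = c *\<^sub>C (x * y)"
    and mult_scaleC_right: "x * (c *\<^sub>C y) = c *\<^sub>C (x * y)"

global_interpretation complex_vector:
  vector_space "scaleC :: complex \<Rightarrow> 'a \<Rightarrow> 'a::complex_vector"
  by unfold_locales (rule scaleC_add_right scaleC_add_left scaleC_scaleC scaleC_one)+

global_interpretation complex_vector:
  vector_space_pair "scaleC :: complex \<Rightarrow> 'a \<Rightarrow> 'a::complex_vector"
    "scaleC :: complex \<Rightarrow> 'b \<Rightarrow> 'b::complex_vector"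
  by unfold_locales

abbreviation clinear :: "('a::complex_vector \<Rightarrow> 'b::complex_vector) \<Rightarrow> bool" where
  "clinear \<equiv> Vector_Spaces.linear scaleC scaleC"

lemma clinearI:
  assumes "\<And>x y. f (x + y) = f x + f y" and "\<And>c x. f (c *\<^sub>C x) = c *\<^sub>C f x"
  shows "clinear f"
  using assms by unfold_locales auto

lemma clinear_add: "clinear f \<Longrightarrow> f (x + y) = f x + f y"
  by (rule complex_vector.linear_add)

lemma clinear_scale: "clinear f \<Longrightarrow> f (c *\<^sub>C x) = c *\<^sub>C f x"
  by (rule complex_vector.linear_scale)

definition cbilinear :: "('a::complex_vector \<Rightarrow> 'b::complex_vector \<Rightarrow> 'c::complex_vector) \<Rightarrow> bool" where
  "cbilinear f \<longleftrightarrow> (\<forall>x. clinear (f x)) \<and> (\<forall>y. clinear (\<lambda>x. f x y))"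

instantiation complex :: complex_algebra_1
begin

definition scaleC_complex :: "complex \<Rightarrow> complex \<Rightarrow> complex" where
  "scaleC_complex c x = c * x"

instance
  by intro_classes (simp_all add: scaleC_complex_def algebra_simps)

end

instantiation poly_mapping :: (type, complex_vector) complex_vector
begin

definition scaleC_poly_mapping :: "complex \<Rightarrow> ('a \<Rightarrow>\<^sub>0 'b) \<Rightarrow> ('a \<Rightarrow>\<^sub>0 'b)" where
  "scaleC_poly_mapping c p = Poly_Mapping.map (scaleC c) p"

lemma lookup_scaleC: "Poly_Mapping.lookup (c *\<^sub>C p) k = c *\<^sub>C Poly_Mapping.lookup p k"
  for p :: "'a \<Rightarrow>\<^sub>0 'b"
  by (simp add: scaleC_poly_mapping_def Poly_Mapping.map.rep_eq when_def)

instance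
  by intro_classes (simp_all add: poly_mapping_eq_iff fun_eq_iff lookup_scaleC lookup_add
      scaleC_add_right scaleC_add_left scaleC_scaleC scaleC_one)

end


section \<open>The tensor product of complex vector spaces\<close>

text \<open>The quotient of the free vector space on pairs by the bilinearity relations.\<close>

definition tensor_relations :: "('a::complex_vector \<times> 'b::complex_vector \<Rightarrow>\<^sub>0 complex) set" where
  "tensor_relations =
     {Poly_Mapping.single (x + x', y) 1 - Poly_Mapping.single (x, y) 1
        - Poly_Mapping.single (x', y) 1 |x x' y. True}
   \<union> {Poly_Mapping.single (x, y + y') 1 - Poly_Mapping.single (x, y) 1
        - Poly_Mapping.single (x, y') 1 |x y y'. True}
   \<union> {Poly_Mapping.single (c *\<^sub>C x, y) 1 - c *\<^sub>C Poly_Mapping.single (x, y) 1 |c x y. True}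
   \<union> {Poly_Mapping.single (x, c *\<^sub>C y) 1 - c *\<^sub>C Poly_Mapping.single (x, y) 1 |c x y. True}"

definition tensor_eq ::
  "('a::complex_vector \<times> 'b::complex_vector \<Rightarrow>\<^sub>0 complex) \<Rightarrow> ('a \<times> 'b \<Rightarrow>\<^sub>0 complex) \<Rightarrow> bool" where
  "tensor_eq p q \<longleftrightarrow> p - q \<in> complex_vector.span tensor_relations"

lemma tensor_eq_refl: "tensor_eq p p"
  by (simp add: tensor_eq_def complex_vector.span_zero)

lemma tensor_eq_sym: "tensor_eq p q \<Longrightarrow> tensor_eq q p"
  unfolding tensor_eq_def by (drule complex_vector.span_neg) simp

lemma tensor_eq_trans: "tensor_eq p q \<Longrightarrow> tensor_eq q r \<Longrightarrow> tensor_eq p r"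
  unfolding tensor_eq_def by (drule (1) complex_vector.span_add) simp

lemma equivp_tensor_eq: "equivp tensor_eq"
  by (intro equivpI reflpI sympI transpI) (fact tensor_eq_refl tensor_eq_sym tensor_eq_trans)+

quotient_type (overloaded) ('a, 'b) tensor =
  "('a::complex_vector \<times> 'b::complex_vector \<Rightarrow>\<^sub>0 complex)" / tensor_eq
  by (rule equivp_tensor_eq)

instantiation tensor :: (complex_vector, complex_vector) complex_vector
begin

lift_definition zero_tensor :: "('a, 'b) tensor" is 0 .

lift_definition plus_tensor :: "('a, 'b) tensor \<Rightarrow> ('a, 'b) tensor \<Rightarrow> ('a, 'b) tensor" is "(+)"
  unfolding tensor_eq_def by (drule (1) complex_vector.span_add) (simp add: algebra_simps)

lift_definition uminus_tensor :: "('a, 'b) tensor \<Rightarrow> ('a, 'b) tensor" is uminus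
  unfolding tensor_eq_def by (drule complex_vector.span_neg) simp

lift_definition minus_tensor :: "('a, 'b) tensor \<Rightarrow> ('a, 'b) tensor \<Rightarrow> ('a, 'b) tensor" is "(-)"
  unfolding tensor_eq_def
  by (drule (1) complex_vector.span_diff) (simp add: algebra_simps)

lift_definition scaleC_tensor :: "complex \<Rightarrow> ('a, 'b) tensor \<Rightarrow> ('a, 'b) tensor" is scaleC
  unfolding tensor_eq_def
  by (drule complex_vector.span_scale) (simp add: complex_vector.scale_right_diff_distrib)

instance
  by intro_classes
    (transfer, simp add: tensor_eq_def complex_vector.span_zero algebra_simps
      scaleC_add_right scaleC_add_left scaleC_scaleC scaleC_one)+

end

lift_definition tensor :: "'a::complex_vector \<Rightarrow> 'b::complex_vector \<Rightarrow> ('a, 'b) tensor"  (infixr \<open>\<otimes>\<close> 72)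
  is "\<lambda>x y. Poly_Mapping.single (x, y) 1" .

text \<open>The linear map out of the tensor product that a bilinear map induces; the value is meaningless
  if the argument is not bilinear.\<close>

definition tensor_lift ::
  "('a::complex_vector \<Rightarrow> 'b::complex_vector \<Rightarrow> 'c::complex_vector) \<Rightarrow> ('a, 'b) tensor \<Rightarrow> 'c" where
  "tensor_lift f = (THE g. clinear g \<and> (\<forall>x y. g (x \<otimes> y) = f x y))"

lemma cbilinearD:
  assumes "cbilinear f"
  shows "f (x + x') y = f x y + f x' y" "f x (y + y') = f x y + f x y'"
    "f (c *\<^sub>C x) y = c *\<^sub>C f x y" "f x (c *\<^sub>C y) = c *\<^sub>C f x y"
  using assms clinear_add clinear_scale unfolding cbilinear_def by metis+

lemma cbilinearI:
  assumes "\<And>x x' y. f (x + x') y = f x y + f x' y" "\<And>x y y'. f x (y + y') = f x y + f x y'"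
    "\<And>c x y. f (c *\<^sub>C x) y = c *\<^sub>C f x y" "\<And>c x y. f x (c *\<^sub>C y) = c *\<^sub>C f x y"
  shows "cbilinear f"
  unfolding cbilinear_def using assms by (auto intro!: clinearI)

lemma tensor_eqI: "p - q \<in> tensor_relations \<Longrightarrow> tensor_eq p q"
  by (simp add: tensor_eq_def complex_vector.span_base)

lemma cbilinear_tensor: "cbilinear (\<otimes>)"
proof (rule cbilinearI; transfer)
  show "tensor_eq (Poly_Mapping.single (x + x', y) 1)
      (Poly_Mapping.single (x, y) 1 + Poly_Mapping.single (x', y) 1)" for x x' :: 'a and y :: 'b
    by (rule tensor_eqI, unfold tensor_relations_def diff_diff_add[symmetric]) blast
  show "tensor_eq (Poly_Mapping.single (x, y + y') 1)
      (Poly_Mapping.single (x, y) 1 + Poly_Mapping.single (x, y') 1)" for x :: 'a and y y' :: 'b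
    by (rule tensor_eqI, unfold tensor_relations_def diff_diff_add[symmetric]) blast
  show "tensor_eq (Poly_Mapping.single (c *\<^sub>C x, y) 1) (c *\<^sub>C Poly_Mapping.single (x, y) 1)"
    for c and x :: 'a and y :: 'b
    by (rule tensor_eqI, unfold tensor_relations_def) blast
  show "tensor_eq (Poly_Mapping.single (x, c *\<^sub>C y) 1) (c *\<^sub>C Poly_Mapping.single (x, y) 1)"
    for c and x :: 'a and y :: 'b
    by (rule tensor_eqI, unfold tensor_relations_def) blast
qed

definition free_lift :: "('k \<Rightarrow> 'c::complex_vector) \<Rightarrow> ('k \<Rightarrow>\<^sub>0 complex) \<Rightarrow> 'c" where
  "free_lift f p = (\<Sum>k\<in>Poly_Mapping.keys p. Poly_Mapping.lookup p k *\<^sub>C f k)"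

lemma free_lift_superset:
  assumes "finite A" "Poly_Mapping.keys p \<subseteq> A"
  shows "free_lift f p = (\<Sum>k\<in>A. Poly_Mapping.lookup p k *\<^sub>C f k)"
  unfolding free_lift_def
  by (rule sum.mono_neutral_left) (use assms in \<open>auto simp: in_keys_iff\<close>)

lemma free_lift_single: "free_lift f (Poly_Mapping.single k 1) = f k"
  by (simp add: free_lift_def scaleC_one)

lemma clinear_free_lift: "clinear (free_lift f)"
proof (rule clinearI)
  fix p q :: "'a \<Rightarrow>\<^sub>0 complex"
  let ?A = "Poly_Mapping.keys p \<union> Poly_Mapping.keys q"
  have "free_lift f (p + q) = (\<Sum>k\<in>?A. Poly_Mapping.lookup (p + q) k *\<^sub>C f k)"
    by (rule free_lift_superset) (use keys_add[of p q] in auto)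
  also have "\<dots> = (\<Sum>k\<in>?A. Poly_Mapping.lookup p k *\<^sub>C f k) + (\<Sum>k\<in>?A. Poly_Mapping.lookup q k *\<^sub>C f k)"
    by (simp add: lookup_add scaleC_add_left sum.distrib)
  also have "\<dots> = free_lift f p + free_lift f q"
    by (simp add: free_lift_superset[of ?A])
  finally show "free_lift f (p + q) = free_lift f p + free_lift f q" .
next
  fix c and p :: "'a \<Rightarrow>\<^sub>0 complex"
  have "free_lift f (c *\<^sub>C p) = (\<Sum>k\<in>Poly_Mapping.keys p. Poly_Mapping.lookup (c *\<^sub>C p) k *\<^sub>C f k)"
    by (rule free_lift_superset) (auto simp: in_keys_iff lookup_scaleC scaleC_complex_def)
  also have "\<dots> = c *\<^sub>C free_lift f p"
    by (simp add: free_lift_def lookup_scaleC scaleC_complex_def complex_vector.scale_sum_right scaleC_scaleC)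
  finally show "free_lift f (c *\<^sub>C p) = c *\<^sub>C free_lift f p" .
qed

lemma free_sum_singles:
  fixes p :: "'k \<Rightarrow>\<^sub>0 complex"
  shows "(\<Sum>k\<in>Poly_Mapping.keys p. Poly_Mapping.lookup p k *\<^sub>C Poly_Mapping.single k 1) = p"
proof (rule poly_mapping_eqI)
  fix j
  have "Poly_Mapping.lookup p k * (1 when k = j) = (if k = j then Poly_Mapping.lookup p k else 0)" for k
    by (simp add: when_def)
  then show "Poly_Mapping.lookup (\<Sum>k\<in>Poly_Mapping.keys p. Poly_Mapping.lookup p k *\<^sub>C Poly_Mapping.single k 1) j
      = Poly_Mapping.lookup p j"
    by (simp add: lookup_sum lookup_scaleC lookup_single scaleC_complex_def in_keys_iff)
qed

lemma tensor_unique: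
  fixes g h :: "('a::complex_vector, 'b::complex_vector) tensor \<Rightarrow> 'c::complex_vector"
  assumes "clinear g" "clinear h" and "\<And>x y. g (x \<otimes> y) = h (x \<otimes> y)"
  shows "g = h"
proof
  fix t :: "('a, 'b) tensor"
  obtain p where t: "t = abs_tensor p"
    by (metis Quotient_tensor Quotient_abs_rep)
  have single: "abs_tensor (Poly_Mapping.single k 1) = fst k \<otimes> snd k" for k :: "'a \<times> 'b"
    by (simp add: tensor.abs_eq)
  have lin: "clinear (abs_tensor :: ('a \<times> 'b \<Rightarrow>\<^sub>0 complex) \<Rightarrow> _)"
    by (rule clinearI) (simp_all add: plus_tensor.abs_eq scaleC_tensor.abs_eq)
  have "t = abs_tensor (\<Sum>k\<in>Poly_Mapping.keys p. Poly_Mapping.lookup p k *\<^sub>C Poly_Mapping.single k 1)"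
    by (simp add: free_sum_singles t)
  also have "\<dots> = (\<Sum>k\<in>Poly_Mapping.keys p. Poly_Mapping.lookup p k *\<^sub>C (fst k \<otimes> snd k))"
    by (simp add: complex_vector.linear_sum[OF lin] clinear_scale[OF lin] single)
  finally have t': "t = (\<Sum>k\<in>Poly_Mapping.keys p. Poly_Mapping.lookup p k *\<^sub>C (fst k \<otimes> snd k))" .
  show "g t = h t"
    unfolding t' by (simp add: complex_vector.linear_sum clinear_scale assms)
qed

lemma tensor_lift_ex1:
  assumes f: "cbilinear f"
  shows "\<exists>!g. clinear g \<and> (\<forall>x y. g (x \<otimes> y) = f x y)"
proof (rule ex_ex1I)
  let ?F = "free_lift (case_prod f)"
  note lin = clinear_free_lift[of "case_prod f"]
  have kill: "?F p = 0" if "p \<in> complex_vector.span tensor_relations" for p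
    using that
  proof (rule complex_vector.span_induct)
    show "complex_vector.subspace {p. ?F p = 0}"
      by (simp add: complex_vector.subspace_def clinear_add[OF lin] clinear_scale[OF lin]
          complex_vector.linear_0[OF lin])
    show "?F p = 0" if "p \<in> tensor_relations" for p
      using that
      by (auto simp: tensor_relations_def complex_vector.linear_diff[OF lin] clinear_scale[OF lin]
          free_lift_single cbilinearD[OF f])
  qed
  have resp: "?F p = ?F q" if "tensor_eq p q" for p q
    using kill[of "p - q"] that
    by (simp add: tensor_eq_def complex_vector.linear_diff[OF lin])
  define g where "g t = ?F (rep_tensor t)" for t
  have g: "g (abs_tensor p) = ?F p" for p
    unfolding g_def
    by (rule resp) (metis Quotient_tensor Quotient_rep_abs equivp_reflp equivp_tensor_eq)
  have "clinear g"
  proof (rule clinearI)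
    fix s t :: "('a, 'b) tensor" and c
    obtain p q where "s = abs_tensor p" "t = abs_tensor q"
      by (metis Quotient_tensor Quotient_abs_rep)
    then show "g (s + t) = g s + g t" "g (c *\<^sub>C s) = c *\<^sub>C g s"
      by (simp_all add: g plus_tensor.abs_eq scaleC_tensor.abs_eq clinear_add[OF lin] clinear_scale[OF lin])
  qed
  moreover have "g (x \<otimes> y) = f x y" for x y
    by (simp add: tensor.abs_eq g free_lift_single)
  ultimately show "\<exists>g. clinear g \<and> (\<forall>x y. g (x \<otimes> y) = f x y)"
    by blast
qed (metis tensor_unique)

lemma
  assumes "cbilinear f"
  shows clinear_tensor_lift: "clinear (tensor_lift f)"
    and tensor_lift_tensor: "tensor_lift f (x \<otimes> y) = f x y"
  using theI'[OF tensor_lift_ex1[OF assms]] unfolding tensor_lift_def by auto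

definition tensor_map ::
  "('a::complex_vector \<Rightarrow> 'c::complex_vector) \<Rightarrow> ('b::complex_vector \<Rightarrow> 'd::complex_vector)
    \<Rightarrow> ('a, 'b) tensor \<Rightarrow> ('c, 'd) tensor" where
  "tensor_map f g = tensor_lift (\<lambda>x y. f x \<otimes> g y)"

definition tensor_flip :: "('a::complex_vector, 'b::complex_vector) tensor \<Rightarrow> ('b, 'a) tensor" where
  "tensor_flip = tensor_lift (\<lambda>x y. y \<otimes> x)"

definition tensor_assoc ::
  "(('a::complex_vector, 'b::complex_vector) tensor, 'c::complex_vector) tensor
    \<Rightarrow> ('a, ('b, 'c) tensor) tensor" where
  "tensor_assoc = tensor_lift (\<lambda>t z. tensor_lift (\<lambda>x y. x \<otimes> (y \<otimes> z)) t)"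

text \<open>The factorwise product. The products on the factors are explicit arguments because one and the
  same vector space will carry several of them.\<close>

definition tensor_mult ::
  "('a::complex_vector \<Rightarrow> 'a \<Rightarrow> 'a) \<Rightarrow> ('b::complex_vector \<Rightarrow> 'b \<Rightarrow> 'b)
    \<Rightarrow> ('a, 'b) tensor \<Rightarrow> ('a, 'b) tensor \<Rightarrow> ('a, 'b) tensor" where
  "tensor_mult m m' s t =
     tensor_lift (\<lambda>a b. tensor_lift (\<lambda>c d. m a c \<otimes> m' b d) t) s"

text \<open>Leg notation. Threefold tensor products are nested to the right, and \<open>u\<close> is the unit of
  the factor that is left out.\<close>

definition leg12 ::
  "'c \<Rightarrow> ('a::complex_vector, 'b::complex_vector) tensor \<Rightarrow> ('a, ('b, 'c::complex_vector) tensor) tensor" where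
  "leg12 u = tensor_lift (\<lambda>x y. x \<otimes> (y \<otimes> u))"

definition leg13 ::
  "'b \<Rightarrow> ('a::complex_vector, 'c::complex_vector) tensor \<Rightarrow> ('a, ('b::complex_vector, 'c) tensor) tensor" where
  "leg13 u = tensor_lift (\<lambda>x z. x \<otimes> (u \<otimes> z))"

definition leg23 ::
  "'a \<Rightarrow> ('b::complex_vector, 'c::complex_vector) tensor \<Rightarrow> ('a::complex_vector, ('b, 'c) tensor) tensor" where
  "leg23 u t = u \<otimes> t"


section \<open>Quasitriangular bialgebras with involution\<close>

abbreviation mult2 ::
  "('h::complex_algebra_1, 'h) tensor \<Rightarrow> ('h, 'h) tensor \<Rightarrow> ('h, 'h) tensor" where
  "mult2 \<equiv> tensor_mult (*) (*)"

abbreviation mult3 ::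
  "('h::complex_algebra_1, ('h, 'h) tensor) tensor \<Rightarrow> ('h, ('h, 'h) tensor) tensor
    \<Rightarrow> ('h, ('h, 'h) tensor) tensor" where
  "mult3 \<equiv> tensor_mult (*) mult2"

locale bialgebra =
  fixes \<Delta> :: "'h::complex_algebra_1 \<Rightarrow> ('h, 'h) tensor"
    and \<epsilon> :: "'h \<Rightarrow> complex"
  assumes linear_comult: "clinear \<Delta>"
    and linear_counit: "clinear \<epsilon>"
    and coassoc: "tensor_assoc (tensor_map \<Delta> id (\<Delta> x)) = tensor_map id \<Delta> (\<Delta> x)"
    and counit_left: "tensor_lift (\<lambda>y z. \<epsilon> y *\<^sub>C z) (\<Delta> x) = x"
    and counit_right: "tensor_lift (\<lambda>y z. \<epsilon> z *\<^sub>C y) (\<Delta> x) = x"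
    and comult_mult: "\<Delta> (x * y) = mult2 (\<Delta> x) (\<Delta> y)"
    and comult_one: "\<Delta> 1 = 1 \<otimes> 1"
    and counit_mult: "\<epsilon> (x * y) = \<epsilon> x * \<epsilon> y"
    and counit_one: "\<epsilon> 1 = 1"

locale quasitriangular_bialgebra = bialgebra \<Delta> \<epsilon>
  for \<Delta> :: "'h::complex_algebra_1 \<Rightarrow> ('h, 'h) tensor" and \<epsilon> :: "'h \<Rightarrow> complex" +
  fixes R :: "('h, 'h) tensor"
  assumes R_invertible: "\<exists>Q. mult2 R Q = 1 \<otimes> 1 \<and> mult2 Q R = 1 \<otimes> 1"
    and comult_id_R: "tensor_assoc (tensor_map \<Delta> id R) = mult3 (leg13 1 R) (leg23 1 R)"
    and id_comult_R: "tensor_map id \<Delta> R = mult3 (leg13 1 R) (leg12 1 R)"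
    and R_comult: "mult2 R (\<Delta> h) = mult2 (tensor_flip (\<Delta> h)) R"

locale bialgebra_involution = bialgebra \<Delta> \<epsilon>
  for \<Delta> :: "'h::complex_algebra_1 \<Rightarrow> ('h, 'h) tensor" and \<epsilon> :: "'h \<Rightarrow> complex" +
  fixes \<tau> :: "'h \<Rightarrow> 'h"
  assumes linear_inv: "clinear \<tau>"
    and inv_inv: "\<tau> (\<tau> x) = x"
    and comult_inv: "\<Delta> (\<tau> x) = tensor_map \<tau> \<tau> (\<Delta> x)"
    and counit_inv: "\<epsilon> (\<tau> x) = \<epsilon> x"
    and inv_mult: "\<tau> (x * y) = \<tau> y * \<tau> x"
    and inv_one: "\<tau> 1 = 1"

definition tensor_inverse :: "('h::complex_algebra_1, 'h) tensor \<Rightarrow> ('h, 'h) tensor" where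
  "tensor_inverse t = (THE s. mult2 t s = 1 \<otimes> 1 \<and> mult2 s t = 1 \<otimes> 1)"

definition R_prime :: "('h::complex_algebra_1 \<Rightarrow> 'h) \<Rightarrow> ('h, 'h) tensor \<Rightarrow> ('h, 'h) tensor" where
  "R_prime \<tau> R = tensor_lift (\<lambda>x y. \<tau> x \<otimes> y) R"

definition R_dprime :: "('h::complex_algebra_1 \<Rightarrow> 'h) \<Rightarrow> ('h, 'h) tensor \<Rightarrow> ('h, 'h) tensor" where
  "R_dprime \<tau> R = tensor_lift (\<lambda>x y. y \<otimes> \<tau> x) R"


section \<open>The dual and the RE dual\<close>

typedef (overloaded) 'a dual = "{a :: 'a::complex_vector \<Rightarrow> complex. clinear a}"
  morphisms pairing Abs_dual
  by (rule exI[of _ "\<lambda>_. 0"]) (auto intro!: clinearI simp: scaleC_complex_def)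

setup_lifting type_definition_dual

instantiation dual :: (complex_vector) complex_vector
begin

lift_definition zero_dual :: "'a dual" is "\<lambda>_. 0"
  by (rule clinearI) (simp_all add: scaleC_complex_def)

lift_definition plus_dual :: "'a dual \<Rightarrow> 'a dual \<Rightarrow> 'a dual" is "\<lambda>a b x. a x + b x"
  by (rule clinearI) (simp_all add: clinear_add clinear_scale scaleC_complex_def algebra_simps)

lift_definition uminus_dual :: "'a dual \<Rightarrow> 'a dual" is "\<lambda>a x. - a x"
  by (rule clinearI) (simp_all add: clinear_add clinear_scale scaleC_complex_def algebra_simps)

lift_definition minus_dual :: "'a dual \<Rightarrow> 'a dual \<Rightarrow> 'a dual" is "\<lambda>a b x. a x - b x"
  by (rule clinearI) (simp_all add: clinear_add clinear_scale scaleC_complex_def algebra_simps)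

lift_definition scaleC_dual :: "complex \<Rightarrow> 'a dual \<Rightarrow> 'a dual" is "\<lambda>c a x. c * a x"
  by (rule clinearI) (simp_all add: clinear_add clinear_scale scaleC_complex_def algebra_simps)

instance
  by intro_classes (transfer, simp add: fun_eq_iff algebra_simps)+

end

lift_definition act_left :: "'h::complex_algebra_1 \<Rightarrow> 'h dual \<Rightarrow> 'h dual" is "\<lambda>h a x. a (x * h)"
  by (rule clinearI) (simp_all add: clinear_add clinear_scale distrib_right mult_scaleC_left)

lift_definition act_right :: "'h::complex_algebra_1 dual \<Rightarrow> 'h \<Rightarrow> 'h dual" is "\<lambda>a h x. a (h * x)"
  by (rule clinearI) (simp_all add: clinear_add clinear_scale distrib_left mult_scaleC_right)

definition dual_mult ::
  "('h::complex_algebra_1 \<Rightarrow> ('h, 'h) tensor) \<Rightarrow> 'h dual \<Rightarrow> 'h dual \<Rightarrow> 'h dual" where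
  "dual_mult \<Delta> a b = Abs_dual (\<lambda>x. tensor_lift (\<lambda>y z. pairing a y * pairing b z) (\<Delta> x))"

lemma clinear_pairing: "clinear (pairing a)"
  using pairing[of a] by simp

lemma pairing_dual_mult:
  assumes "clinear \<Delta>"
  shows "pairing (dual_mult \<Delta> a b) x = tensor_lift (\<lambda>y z. pairing a y * pairing b z) (\<Delta> x)"
proof -
  let ?f = "\<lambda>y z. pairing a y * pairing b z"
  have "cbilinear ?f"
    by (rule cbilinearI)
      (simp_all add: clinear_add[OF clinear_pairing] clinear_scale[OF clinear_pairing]
        scaleC_complex_def algebra_simps)
  then have "clinear (tensor_lift ?f)"
    by (rule clinear_tensor_lift)
  then have "clinear (\<lambda>x. tensor_lift ?f (\<Delta> x))"
    by (intro clinearI) (simp_all add: clinear_add[OF assms] clinear_scale[OF assms] clinear_add clinear_scale)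
  then show ?thesis
    by (simp add: dual_mult_def Abs_dual_inverse)
qed

definition RE_mult ::
  "('h::complex_algebra_1 \<Rightarrow> ('h, 'h) tensor) \<Rightarrow> ('h, 'h) tensor \<Rightarrow> ('h \<Rightarrow> 'h)
    \<Rightarrow> 'h dual \<Rightarrow> 'h dual \<Rightarrow> 'h dual" where
  "RE_mult \<Delta> R \<tau> a b =
     tensor_lift (\<lambda>u v. dual_mult \<Delta> (act_left (\<tau> u) a) (act_right b v)) (tensor_inverse R)"

text \<open>The counit is the unit of the dual algebra, and also of the RE dual, since
  \<open>\<epsilon> \<circ> \<tau> = \<epsilon>\<close> and both \<open>\<epsilon> \<otimes> id\<close> and \<open>id \<otimes> \<epsilon>\<close> send the R-matrix to \<open>1\<close>.\<close>

definition RE_one :: "('h::complex_algebra_1 \<Rightarrow> complex) \<Rightarrow> 'h dual" where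
  "RE_one \<epsilon> = Abs_dual \<epsilon>"

lemma pairing_RE_one: "clinear \<epsilon> \<Longrightarrow> pairing (RE_one \<epsilon>) x = \<epsilon> x"
  by (simp add: RE_one_def Abs_dual_inverse)

abbreviation mult_HD ::
  "('h::complex_algebra_1 \<Rightarrow> ('h, 'h) tensor) \<Rightarrow> ('h, 'h) tensor \<Rightarrow> ('h \<Rightarrow> 'h)
    \<Rightarrow> ('h, 'h dual) tensor \<Rightarrow> ('h, 'h dual) tensor \<Rightarrow> ('h, 'h dual) tensor" where
  "mult_HD \<Delta> R \<tau> \<equiv> tensor_mult (*) (RE_mult \<Delta> R \<tau>)"

abbreviation mult_HHD ::
  "('h::complex_algebra_1 \<Rightarrow> ('h, 'h) tensor) \<Rightarrow> ('h, 'h) tensor \<Rightarrow> ('h \<Rightarrow> 'h)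
    \<Rightarrow> ('h, ('h, 'h dual) tensor) tensor \<Rightarrow> ('h, ('h, 'h dual) tensor) tensor
    \<Rightarrow> ('h, ('h, 'h dual) tensor) tensor" where
  "mult_HHD \<Delta> R \<tau> \<equiv> tensor_mult (*) (mult_HD \<Delta> R \<tau>)"


section \<open>The universal S-matrix\<close>

definition is_basis :: "'a::complex_vector set \<Rightarrow> bool" where
  "is_basis B \<longleftrightarrow> \<not> complex_vector.dependent B \<and> complex_vector.span B = UNIV"

definition dual_basis :: "'a::complex_vector set \<Rightarrow> 'a \<Rightarrow> 'a dual" where
  "dual_basis B e = Abs_dual (\<lambda>x. complex_vector.representation B x e)"

lemma pairing_dual_basis:
  assumes "is_basis B"
  shows "pairing (dual_basis B e) x = complex_vector.representation B x e"
proof -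
  have "clinear (\<lambda>x. complex_vector.representation B x e)"
    using assms unfolding is_basis_def
    by (intro clinearI) (simp_all add: complex_vector.representation_add
        complex_vector.representation_scale scaleC_complex_def)
  then show ?thesis
    by (simp add: dual_basis_def Abs_dual_inverse)
qed

definition S_matrix :: "'h::complex_vector set \<Rightarrow> ('h, 'h dual) tensor" where
  "S_matrix B = (\<Sum>e\<in>B. e \<otimes> dual_basis B e)"

lemma dual_eqI: "(\<And>x. pairing a x = pairing b x) \<Longrightarrow> a = b"
  by transfer auto

lemma cbilinear_pairing_scale: "cbilinear (\<lambda>x w. pairing a x *\<^sub>C w)"
  by (rule cbilinearI)
    (simp_all add: clinear_add[OF clinear_pairing] clinear_scale[OF clinear_pairing]
      scaleC_add_left scaleC_add_right scaleC_scaleC scaleC_complex_def mult.commute)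

lemma pairing_sum: "pairing (\<Sum>i\<in>I. f i) x = (\<Sum>i\<in>I. pairing (f i) x)"
  by (induction I rule: infinite_finite_induct) (simp_all add: zero_dual.rep_eq plus_dual.rep_eq)

lemma cbilinear_map: "clinear f \<Longrightarrow> clinear g \<Longrightarrow> cbilinear (\<lambda>x y. f x \<otimes> g y)"
  by (rule cbilinearI) (simp_all add: clinear_add clinear_scale cbilinearD[OF cbilinear_tensor])

lemma dual_expansion:
  assumes "finite B" "is_basis B"
  shows "a = (\<Sum>e\<in>B. pairing a e *\<^sub>C dual_basis B e)"
proof (rule dual_eqI)
  fix x
  have "x = (\<Sum>e\<in>B. complex_vector.representation B x e *\<^sub>C e)"
    using assms unfolding is_basis_def by (subst complex_vector.sum_representation_eq) auto
  then have "pairing a x = pairing a (\<Sum>e\<in>B. complex_vector.representation B x e *\<^sub>C e)"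
    by simp
  then show "pairing a x = pairing (\<Sum>e\<in>B. pairing a e *\<^sub>C dual_basis B e) x"
    by (simp add: complex_vector.linear_sum[OF clinear_pairing] clinear_scale[OF clinear_pairing]
        pairing_sum scaleC_dual.rep_eq pairing_dual_basis[OF assms(2)] scaleC_complex_def mult.commute)
qed

text \<open>A linear map on the dual is determined by its value on the second factor of the S-matrix, and
  that value is arbitrary.\<close>

lemma S_matrix_determines:
  fixes T :: "('h::complex_vector, 'w::complex_vector) tensor"
  assumes B: "finite B" "is_basis B"
  shows "\<exists>!\<delta>. clinear \<delta> \<and> tensor_map id \<delta> (S_matrix B) = T"
proof (rule ex_ex1I)
  define ev :: "'h dual \<Rightarrow> ('h, 'w) tensor \<Rightarrow> 'w"
    where "ev a = tensor_lift (\<lambda>x w. pairing a x *\<^sub>C w)" for a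
  have ev_lin: "clinear (ev a)" for a
    unfolding ev_def by (rule clinear_tensor_lift[OF cbilinear_pairing_scale])
  have ev: "ev a (x \<otimes> w) = pairing a x *\<^sub>C w" for a x and w :: 'w
    unfolding ev_def by (rule tensor_lift_tensor[OF cbilinear_pairing_scale])
  have ev_add: "ev (a + b) = (\<lambda>t :: ('h, 'w) tensor. ev a t + ev b t)" for a b
    by (rule tensor_unique)
      (auto intro!: clinearI simp: clinear_add[OF ev_lin] clinear_scale[OF ev_lin] ev
        plus_dual.rep_eq scaleC_add_left scaleC_add_right)
  have ev_scale: "ev (c *\<^sub>C a) = (\<lambda>t :: ('h, 'w) tensor. c *\<^sub>C ev a t)" for c a
    by (rule tensor_unique)
      (auto intro!: clinearI simp: clinear_add[OF ev_lin] clinear_scale[OF ev_lin] ev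
        scaleC_dual.rep_eq scaleC_add_right scaleC_scaleC mult.commute)
  have map_S: "tensor_map id \<delta> (S_matrix B) = (\<Sum>e\<in>B. e \<otimes> \<delta> (dual_basis B e))"
    if "clinear \<delta>" for \<delta> :: "'h dual \<Rightarrow> 'w"
  proof -
    have bil: "cbilinear (\<lambda>x y. x \<otimes> \<delta> y)"
      by (rule cbilinear_map[OF _ that]) (auto intro!: clinearI)
    show ?thesis
      unfolding tensor_map_def S_matrix_def id_apply
      by (simp only: complex_vector.linear_sum[OF clinear_tensor_lift[OF bil]]
          tensor_lift_tensor[OF bil])
  qed
  let ?\<delta> = "\<lambda>a. ev a T"
  have lin: "clinear ?\<delta>"
    by (rule clinearI) (simp_all add: ev_add ev_scale)
  have "(\<lambda>t :: ('h, 'w) tensor. \<Sum>e\<in>B. e \<otimes> ev (dual_basis B e) t) = (\<lambda>t. t)"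
  proof (rule tensor_unique)
    show "clinear (\<lambda>t :: ('h, 'w) tensor. \<Sum>e\<in>B. e \<otimes> ev (dual_basis B e) t)"
      by (rule clinearI)
        (simp_all add: clinear_add[OF ev_lin] clinear_scale[OF ev_lin] cbilinearD[OF cbilinear_tensor]
          sum.distrib complex_vector.scale_sum_right)
    show "clinear (\<lambda>t :: ('h, 'w) tensor. t)"
      by (rule clinearI) simp_all
    fix x :: 'h and w :: 'w
    have lin1: "clinear (\<lambda>x. x \<otimes> w)"
      by (rule clinearI) (simp_all add: cbilinearD[OF cbilinear_tensor])
    have "(\<Sum>e\<in>B. e \<otimes> ev (dual_basis B e) (x \<otimes> w))
        = (\<Sum>e\<in>B. complex_vector.representation B x e *\<^sub>C e) \<otimes> w"
      by (simp add: ev pairing_dual_basis[OF B(2)] cbilinearD[OF cbilinear_tensor]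
          complex_vector.linear_sum[OF lin1])
    also have "(\<Sum>e\<in>B. complex_vector.representation B x e *\<^sub>C e) = x"
      using B unfolding is_basis_def by (subst complex_vector.sum_representation_eq) auto
    finally show "(\<Sum>e\<in>B. e \<otimes> ev (dual_basis B e) (x \<otimes> w)) = x \<otimes> w" .
  qed
  then have "tensor_map id ?\<delta> (S_matrix B) = T"
    unfolding map_S[OF lin] by (rule fun_cong)
  with lin show "\<exists>\<delta>. clinear \<delta> \<and> tensor_map id \<delta> (S_matrix B) = T"
    by blast
  fix \<delta> \<delta>' :: "'h dual \<Rightarrow> 'w"
  have char: "\<delta> a = ev a T" if \<delta>: "clinear \<delta> \<and> tensor_map id \<delta> (S_matrix B) = T"
    for a and \<delta> :: "'h dual \<Rightarrow> 'w"
  proof -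
    have "ev a T = (\<Sum>e\<in>B. pairing a e *\<^sub>C \<delta> (dual_basis B e))"
      using \<delta> map_S[of \<delta>] by (auto simp: complex_vector.linear_sum[OF ev_lin] ev)
    also have "\<dots> = \<delta> (\<Sum>e\<in>B. pairing a e *\<^sub>C dual_basis B e)"
      using \<delta> by (simp add: complex_vector.linear_sum clinear_scale)
    finally show ?thesis
      using dual_expansion[OF B, of a] by simp
  qed
  show "\<delta> = \<delta>'" if "clinear \<delta> \<and> tensor_map id \<delta> (S_matrix B) = T"
      "clinear \<delta>' \<and> tensor_map id \<delta>' (S_matrix B) = T"
    using char[OF that(1)] char[OF that(2)] by auto
qed

end

theory Submission
  imports Defs
begin

text \<open>Identify an element of \<open>H \<otimes> H\<^sup>*\<close> with the map \<open>H \<rightarrow> H\<close> that evaluates its second factor.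
  The S-matrix becomes the identity and, writing \<open>Q\<close> for the inverse of \<open>R\<close> and \<open>P\<close> for a second copy of \<open>R\<close>,
  the two coactions become
  \<open>\<delta>(a)(y) = \<langle>a, R\<^sub>1 y \<tau>(P\<^sub>1)\<rangle> R\<^sub>2 P\<^sub>2\<close> and
  \<open>\<delta>'(a)(y) = \<langle>a, R\<^sub>2 y P\<^sub>1\<rangle> \<tau>(R\<^sub>1) P\<^sub>2\<close>. The twist in the RE product inserts
  \<open>\<tau>(Q\<^sub>1)\<close> and \<open>Q\<^sub>2\<close>, which cancel one copy of \<open>R\<close> on each side, because \<open>\<tau>\<close> reverses
  products. What remains is \<open>\<langle>a, R\<^sub>1 y\<^sub>1\<rangle> R\<^sub>2 y\<^sub>2 = \<langle>a, y\<^sub>2 R\<^sub>1\<rangle> y\<^sub>1 R\<^sub>2\<close>,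
  that is, the axiom relating \<open>R\<close> and the coproduct.\<close>

section \<open>Calculus of tensors\<close>

lemma tensor_lift_add: "cbilinear f \<Longrightarrow> tensor_lift f (s + t) = tensor_lift f s + tensor_lift f t"
  by (rule clinear_add[OF clinear_tensor_lift])

lemma tensor_lift_scale: "cbilinear f \<Longrightarrow> tensor_lift f (c *\<^sub>C t) = c *\<^sub>C tensor_lift f t"
  by (rule clinear_scale[OF clinear_tensor_lift])

lemma tensor_lift_sum:
  "cbilinear f \<Longrightarrow> tensor_lift f (\<Sum>i\<in>I. x i \<otimes> y i) = (\<Sum>i\<in>I. f (x i) (y i))"
  by (simp add: complex_vector.linear_sum[OF clinear_tensor_lift] tensor_lift_tensor)

lemmas tensor_lift_simps = tensor_lift_add tensor_lift_scale tensor_lift_tensor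

lemmas tensor_linear = cbilinearD[OF cbilinear_tensor]

lemma clinear_compose: "clinear f \<Longrightarrow> clinear g \<Longrightarrow> clinear (\<lambda>x. f (g x))"
  by (rule clinearI) (simp_all add: clinear_add clinear_scale)

text \<open>The terms come from the support of a representative in the free space, with each
  coefficient absorbed into the first factor. This supplies the finite sums that stand in for
  suppressed summation over tensor components.\<close>

lemma tensor_sum_rep:
  fixes t :: "('a::complex_vector, 'b::complex_vector) tensor"
  obtains I :: "('a \<times> 'b) set" and x y where "t = (\<Sum>i\<in>I. x i \<otimes> y i)"
proof -
  obtain p where t: "t = abs_tensor p"
    by (metis Quotient_tensor Quotient_abs_rep)
  have lin: "clinear (abs_tensor :: ('a \<times> 'b \<Rightarrow>\<^sub>0 complex) \<Rightarrow> _)"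
    by (rule clinearI) (simp_all add: plus_tensor.abs_eq scaleC_tensor.abs_eq)
  have single: "abs_tensor (Poly_Mapping.single k 1) = fst k \<otimes> snd k" for k :: "'a \<times> 'b"
    by (simp add: tensor.abs_eq)
  have "t = abs_tensor (\<Sum>k\<in>Poly_Mapping.keys p. Poly_Mapping.lookup p k *\<^sub>C Poly_Mapping.single k 1)"
    by (simp add: free_sum_singles t)
  also have "\<dots> = (\<Sum>k\<in>Poly_Mapping.keys p. (Poly_Mapping.lookup p k *\<^sub>C fst k) \<otimes> snd k)"
    by (simp add: complex_vector.linear_sum[OF lin] clinear_scale[OF lin] single tensor_linear)
  finally show ?thesis
    by (rule that)
qed

text \<open>Zero and scalar multiples need no cases of their own: a scalar moves into a factor, and
  zero is the pure tensor \<open>0 \<otimes> 0\<close>.\<close>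

lemma tensor_induct [case_names tensor add]:
  assumes "\<And>x y. P (x \<otimes> y)" and "\<And>s t. P s \<Longrightarrow> P t \<Longrightarrow> P (s + t)"
  shows "P t"
proof -
  obtain I :: "('a \<times> 'b) set" and x y where t: "t = (\<Sum>i\<in>I. x i \<otimes> y i)"
    by (rule tensor_sum_rep)
  have "(0 :: 'a) \<otimes> (0 :: 'b) = 0"
    using cbilinearD(3)[OF cbilinear_tensor, of 0 "0 :: 'a" "0 :: 'b"] by simp
  then have "P 0"
    using assms(1)[of 0 0] by simp
  then show ?thesis
    \<comment> \<open>Finiteness of \<open>I\<close> is not recorded in
      \<open>tensor_sum_rep\<close>; a sum over an infinite set is 0 by convention, so
      \<open>P 0\<close> covers that case.\<close>
    unfolding t by (induction I rule: infinite_finite_induct) (simp_all add: assms)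
qed

section \<open>Bilinearity of factorwise products\<close>

lemma cbilinear_inner_tensor_mult:
  assumes "cbilinear m" "cbilinear m'"
  shows "cbilinear (\<lambda>c d. m a c \<otimes> m' b d)"
  by (rule cbilinearI) (simp_all add: tensor_linear cbilinearD[OF assms(1)] cbilinearD[OF assms(2)])

text \<open>Linearity in the parameter is clear on pure tensors and survives addition in
  \<open>t\<close>. It handles nested lifts, where the inner bilinear map depends on the outer
  variables.\<close>

lemma clinear_tensor_lift_param:
  assumes f: "\<And>a. cbilinear (f a)" and g: "\<And>x y. clinear (\<lambda>a. f a x y)"
  shows "clinear (\<lambda>a. tensor_lift (f a) t)"
proof (induction t rule: tensor_induct)
  case (tensor x y)
  show ?case
    by (simp add: tensor_lift_tensor[OF f] g)
next
  case (add s t)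
  show ?case
    by (rule clinearI)
      (simp_all add: tensor_lift_add[OF f] clinear_add[OF add(1)] clinear_add[OF add(2)]
        clinear_scale[OF add(1)] clinear_scale[OF add(2)] scaleC_add_right)
qed

lemma cbilinear_tensor_lift_param:
  assumes "\<And>a b. cbilinear (f a b)" and "\<And>x y. cbilinear (\<lambda>a b. f a b x y)"
  shows "cbilinear (\<lambda>a b. tensor_lift (f a b) t)"
  using assms(2) unfolding cbilinear_def[of "\<lambda>a b. tensor_lift (f a b) t"] cbilinear_def[of "\<lambda>a b. f a b _ _"]
  by (auto intro!: clinear_tensor_lift_param assms(1))

lemma cbilinear_outer_tensor_mult:
  assumes "cbilinear m" "cbilinear m'"
  shows "cbilinear (\<lambda>a b. tensor_lift (\<lambda>c d. m a c \<otimes> m' b d) t)"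
  by (rule cbilinear_tensor_lift_param; rule cbilinearI)
    (simp_all add: tensor_linear cbilinearD[OF assms(1)] cbilinearD[OF assms(2)])

lemma
  assumes "cbilinear m" "cbilinear m'"
  shows cbilinear_tensor_mult: "cbilinear (tensor_mult m m')"
    and tensor_mult_tensor: "tensor_mult m m' (a \<otimes> b) (c \<otimes> d) = m a c \<otimes> m' b d"
proof -
  note [simp] = tensor_lift_simps cbilinear_inner_tensor_mult[OF assms]
    cbilinear_outer_tensor_mult[OF assms]
  show "tensor_mult m m' (a \<otimes> b) (c \<otimes> d) = m a c \<otimes> m' b d"
    unfolding tensor_mult_def
    by (subst tensor_lift_tensor[OF cbilinear_outer_tensor_mult[OF assms]]) simp
  have "clinear (\<lambda>t. tensor_mult m m' s t)" for s
    unfolding tensor_mult_def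
    by (intro clinear_tensor_lift_param cbilinear_outer_tensor_mult clinear_tensor_lift
        cbilinear_inner_tensor_mult assms)
  moreover have "clinear (\<lambda>s. tensor_mult m m' s t)" for t
    unfolding tensor_mult_def
    by (intro clinear_tensor_lift cbilinear_outer_tensor_mult assms)
  ultimately show "cbilinear (tensor_mult m m')"
    by (simp add: cbilinear_def)
qed

lemma tensor_mult_sum:
  assumes "cbilinear m" "cbilinear m'"
  shows "tensor_mult m m' (\<Sum>i\<in>I. a i \<otimes> b i) (\<Sum>j\<in>J. c j \<otimes> d j)
    = (\<Sum>i\<in>I. \<Sum>j\<in>J. m (a i) (c j) \<otimes> m' (b i) (d j))"
  unfolding tensor_mult_def
  by (subst tensor_lift_sum[OF cbilinear_outer_tensor_mult[OF assms]])
    (simp add: tensor_lift_sum cbilinear_inner_tensor_mult[OF assms])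

section \<open>The algebra structure and inverses on the tensor square\<close>

lemma cbilinear_mult: "cbilinear ((*) :: 'h::complex_algebra_1 \<Rightarrow> 'h \<Rightarrow> 'h)"
  by (rule cbilinearI) (simp_all add: algebra_simps mult_scaleC_left mult_scaleC_right)

lemmas mult2_linear = cbilinearD[OF cbilinear_tensor_mult[OF cbilinear_mult cbilinear_mult]]
lemmas mult2_tensor = tensor_mult_tensor[OF cbilinear_mult cbilinear_mult]
lemmas cbilinear_mult2 = cbilinear_tensor_mult[OF cbilinear_mult cbilinear_mult]

lemma mult2_assoc: "mult2 (mult2 s t) u = mult2 s (mult2 t u)"
proof (induction s rule: tensor_induct)
  case (tensor x y)
  show ?case
  proof (induction t rule: tensor_induct)
    case (tensor x' y')
    show ?case
      by (induction u rule: tensor_induct)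
        (simp_all add: mult2_tensor mult2_linear mult.assoc)
  qed (simp add: mult2_linear)
qed (simp add: mult2_linear)

lemma mult2_one_left: "mult2 (1 \<otimes> 1) t = t"
  by (induction t rule: tensor_induct) (simp_all add: mult2_tensor mult2_linear)

lemma mult2_one_right: "mult2 t (1 \<otimes> 1) = t"
  by (induction t rule: tensor_induct) (simp_all add: mult2_tensor mult2_linear)

lemma tensor_inverse_eq:
  assumes "mult2 t s = 1 \<otimes> 1" "mult2 s t = 1 \<otimes> 1"
  shows "tensor_inverse t = s"
  unfolding tensor_inverse_def
proof (rule the_equality)
  fix s' assume "mult2 t s' = 1 \<otimes> 1 \<and> mult2 s' t = 1 \<otimes> 1"
  then show "s' = s"
    using assms by (metis mult2_assoc mult2_one_left mult2_one_right)
qed (use assms in simp)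

text \<open>Applying the linear map induced by \<open>f\<close> to both sides of the hypothesis
  gives the claim. With R and its inverse as the two sums, this is how a copy of R is cancelled
  inside any bilinear expression.\<close>

lemma mult2_one_sum:
  assumes "mult2 (\<Sum>i\<in>I. a i \<otimes> b i) (\<Sum>j\<in>J. c j \<otimes> d j) = 1 \<otimes> 1" and f: "cbilinear f"
  shows "(\<Sum>i\<in>I. \<Sum>j\<in>J. f (a i * c j) (b i * d j)) = f 1 1"
proof -
  have "tensor_lift f (mult2 (\<Sum>i\<in>I. a i \<otimes> b i) (\<Sum>j\<in>J. c j \<otimes> d j)) = f 1 1"
    by (simp add: assms tensor_lift_tensor)
  then show ?thesis
    by (simp add: tensor_mult_sum[OF cbilinear_mult cbilinear_mult]
        complex_vector.linear_sum[OF clinear_tensor_lift[OF f]] tensor_lift_tensor[OF f])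
qed

section \<open>Evaluation of tensors on duals\<close>

text \<open>This is the passage from \<open>W \<otimes> H*\<close> to linear maps from
  \<open>H\<close> to \<open>W\<close>, with the tensor kept fixed and the argument \<open>y\<close>
  varying.\<close>

definition eval_dual :: "'h::complex_vector \<Rightarrow> ('w::complex_vector, 'h dual) tensor \<Rightarrow> 'w" where
  "eval_dual y = tensor_lift (\<lambda>w a. pairing a y *\<^sub>C w)"

definition eval_fst :: "'h::complex_vector dual \<Rightarrow> ('h, 'w::complex_vector) tensor \<Rightarrow> 'w" where
  "eval_fst a = tensor_lift (\<lambda>x w. pairing a x *\<^sub>C w)"

lemmas pairing_linear = clinear_add[OF clinear_pairing] clinear_scale[OF clinear_pairing]
  plus_dual.rep_eq scaleC_dual.rep_eq

lemma cbilinear_eval_dual: "cbilinear (\<lambda>w a. pairing a y *\<^sub>C w)"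
  by (rule cbilinearI) (simp_all add: pairing_linear scaleC_add_left scaleC_add_right scaleC_scaleC mult.commute)

lemmas clinear_eval_dual = clinear_tensor_lift[OF cbilinear_eval_dual, folded eval_dual_def]
lemmas eval_dual_simps = tensor_lift_tensor[OF cbilinear_eval_dual, folded eval_dual_def]
  clinear_add[OF clinear_eval_dual] clinear_scale[OF clinear_eval_dual]

lemmas clinear_eval_fst = clinear_tensor_lift[OF cbilinear_pairing_scale, folded eval_fst_def]
lemmas eval_fst_simps = tensor_lift_tensor[OF cbilinear_pairing_scale, folded eval_fst_def]
  clinear_add[OF clinear_eval_fst] clinear_scale[OF clinear_eval_fst]

lemma basis_expansion:
  assumes "finite B" "is_basis B"
  shows "(\<Sum>e\<in>B. complex_vector.representation B x e *\<^sub>C e) = x"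
  using assms unfolding is_basis_def by (subst complex_vector.sum_representation_eq) auto

text \<open>Expanding the second factor in the dual basis gives this on pure tensors, and both sides
  are additive.\<close>

lemma eval_dual_expansion:
  assumes "finite B" "is_basis B"
  shows "t = (\<Sum>e\<in>B. eval_dual e t \<otimes> dual_basis B e)"
proof (induction t rule: tensor_induct)
  case (tensor w a)
  have lin: "clinear (\<lambda>b. w \<otimes> b)"
    by (rule clinearI) (simp_all add: tensor_linear)
  have "w \<otimes> a = w \<otimes> (\<Sum>e\<in>B. pairing a e *\<^sub>C dual_basis B e)"
    using dual_expansion[OF assms, of a] by simp
  also have "\<dots> = (\<Sum>e\<in>B. eval_dual e (w \<otimes> a) \<otimes> dual_basis B e)"
    by (simp add: complex_vector.linear_sum[OF lin] eval_dual_simps tensor_linear)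
  finally show ?case .
next
  case (add s t)
  then show ?case
    by (simp add: eval_dual_simps tensor_linear sum.distrib)
qed

text \<open>In finite dimension a tensor is recovered from its values, so an identity in
  \<open>H \<otimes> H*\<close> reduces to identities in \<open>H\<close>, one for each
  \<open>y\<close>.\<close>

lemma eval_dual_ext:
  fixes s t :: "('w::complex_vector, 'h::complex_vector dual) tensor" and B :: "'h set"
  assumes "finite B" "is_basis B" and "\<And>y. eval_dual y s = eval_dual y t"
  shows "s = t"
  using eval_dual_expansion[OF assms(1,2), of s] eval_dual_expansion[OF assms(1,2), of t] assms(3)
  by simp

text \<open>The canonical element corresponds to the identity map of \<open>H\<close>.\<close>

lemma eval_dual_S_matrix:
  assumes "finite B" "is_basis B"
  shows "eval_dual y (S_matrix B) = y"
  by (simp add: S_matrix_def complex_vector.linear_sum[OF clinear_eval_dual] eval_dual_simps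
      pairing_dual_basis[OF assms(2)] basis_expansion[OF assms])

lemma eval_fst_S_matrix:
  assumes "finite B" "is_basis B"
  shows "eval_fst a (S_matrix B) = a"
  by (simp add: S_matrix_def complex_vector.linear_sum[OF clinear_eval_fst] eval_fst_simps
      dual_expansion[OF assms, symmetric])

lemma cbilinear_tensor_map_id: "clinear \<delta> \<Longrightarrow> cbilinear (\<lambda>x y. x \<otimes> \<delta> y)"
  by (rule cbilinearI) (simp_all add: clinear_add clinear_scale tensor_linear)

text \<open>The two maps act on different factors. For \<open>t\<close> the S-matrix, the right-hand
  side is \<open>\<delta> a\<close>, so \<open>\<delta>\<close> can be read off from its defining
  equation.\<close>

lemma eval_fst_tensor_map:
  assumes "clinear \<delta>"
  shows "eval_fst a (tensor_map id \<delta> t) = \<delta> (eval_fst a t)"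
  by (induction t rule: tensor_induct)
    (simp_all add: tensor_map_def tensor_lift_simps cbilinear_tensor_map_id[OF assms]
      eval_fst_simps clinear_add[OF assms] clinear_scale[OF assms])

section \<open>The counit and the R-matrix\<close>

lemma cbilinear_leg: "cbilinear (\<lambda>x y. x \<otimes> (y \<otimes> u))" "cbilinear (\<lambda>x z. x \<otimes> (u \<otimes> z))"
  by (rule cbilinearI, simp_all add: tensor_linear)+

lemma tensor_assoc_tensor_tensor: "tensor_assoc ((x \<otimes> y) \<otimes> z) = x \<otimes> (y \<otimes> z)"
  and clinear_tensor_assoc:
    "clinear (tensor_assoc :: (('a::complex_vector, 'b::complex_vector) tensor, 'c::complex_vector) tensor \<Rightarrow> _)"
proof -
  \<comment> \<open>The inner lift must be linear in \<open>z\<close> as well as in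
    \<open>t\<close>; only then does the outer \<open>tensor_lift\<close> have its intended
    value.\<close>
  have lin: "clinear (\<lambda>z :: 'r::complex_vector. tensor_lift (\<lambda>x y. x \<otimes> (y \<otimes> z)) t)"
    for t :: "('p::complex_vector, 'q::complex_vector) tensor"
    by (intro clinear_tensor_lift_param cbilinear_leg clinearI) (simp_all add: tensor_linear)
  have bil: "cbilinear (\<lambda>(t :: ('p::complex_vector, 'q::complex_vector) tensor) (z :: 'r::complex_vector).
      tensor_lift (\<lambda>x y. x \<otimes> (y \<otimes> z)) t)"
    unfolding cbilinear_def by (blast intro: lin clinear_tensor_lift cbilinear_leg)
  show "tensor_assoc ((x \<otimes> y) \<otimes> z) = x \<otimes> (y \<otimes> z)"
    by (simp add: tensor_assoc_def tensor_lift_simps bil cbilinear_leg)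
  show "clinear (tensor_assoc :: (('a::complex_vector, 'b::complex_vector) tensor, 'c::complex_vector) tensor \<Rightarrow> _)"
    unfolding tensor_assoc_def by (rule clinear_tensor_lift[OF bil])
qed

definition functional_snd :: "('b \<Rightarrow> complex) \<Rightarrow> ('w::complex_vector, 'b::complex_vector) tensor \<Rightarrow> 'w" where
  "functional_snd \<chi> = tensor_lift (\<lambda>w x. \<chi> x *\<^sub>C w)"

lemma
  fixes \<chi> :: "'b::complex_vector \<Rightarrow> complex" and w :: "'w::complex_vector"
  assumes "clinear \<chi>"
  shows functional_snd_simps: "functional_snd \<chi> (w \<otimes> x) = \<chi> x *\<^sub>C w"
      "functional_snd \<chi> (s + t) = functional_snd \<chi> s + (functional_snd \<chi> t :: 'w)"
      "functional_snd \<chi> (c *\<^sub>C t) = c *\<^sub>C (functional_snd \<chi> t :: 'w)"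
    and clinear_functional_snd: "clinear (functional_snd \<chi> :: ('w, 'b) tensor \<Rightarrow> 'w)"
proof -
  have "cbilinear (\<lambda>(w :: 'w) x. \<chi> x *\<^sub>C w)"
    by (rule cbilinearI) (simp_all add: clinear_add[OF assms] clinear_scale[OF assms]
        scaleC_add_left scaleC_add_right scaleC_scaleC scaleC_complex_def mult.commute)
  then show "functional_snd \<chi> (w \<otimes> x) = \<chi> x *\<^sub>C w"
      "functional_snd \<chi> (s + t) = functional_snd \<chi> s + (functional_snd \<chi> t :: 'w)"
      "functional_snd \<chi> (c *\<^sub>C t) = c *\<^sub>C (functional_snd \<chi> t :: 'w)"
      "clinear (functional_snd \<chi> :: ('w, 'b) tensor \<Rightarrow> 'w)"
    by (simp_all add: functional_snd_def tensor_lift_simps clinear_tensor_lift)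
qed

text \<open>It suffices to compare pure tensors. The lemma is used for \<open>\<epsilon>\<close> and
  for \<open>\<epsilon> \<otimes> \<epsilon>\<close> on the last two legs, which are both
  multiplicative.\<close>

lemma functional_snd_mult:
  assumes \<chi>: "clinear \<chi>" "\<And>x y. \<chi> (m' x y) = \<chi> x * \<chi> y" and m: "cbilinear m" "cbilinear m'"
  shows "functional_snd \<chi> (tensor_mult m m' s t) = m (functional_snd \<chi> s) (functional_snd \<chi> t)"
proof -
  note [simp] = tensor_mult_tensor[OF m] cbilinearD[OF cbilinear_tensor_mult[OF m]]
    cbilinearD[OF m(1)] functional_snd_simps[OF \<chi>(1)] \<chi>(2) scaleC_scaleC
  show ?thesis
  proof (induction s rule: tensor_induct)
    case (tensor x y)
    show ?case
      by (induction t rule: tensor_induct) (simp_all add: scaleC_add_right mult.commute)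
  qed simp
qed

context bialgebra
begin

definition counit_fst :: "('h, 'w::complex_vector) tensor \<Rightarrow> 'w" where
  "counit_fst = tensor_lift (\<lambda>x w. \<epsilon> x *\<^sub>C w)"

definition counit_snd :: "('w::complex_vector, 'h) tensor \<Rightarrow> 'w" where
  "counit_snd = functional_snd \<epsilon>"

lemmas counit_linear = clinear_add[OF linear_counit] clinear_scale[OF linear_counit]
lemmas comult_linear = clinear_add[OF linear_comult] clinear_scale[OF linear_comult]

lemma cbilinear_counit_fst: "cbilinear (\<lambda>x w. \<epsilon> x *\<^sub>C w)"
  by (rule cbilinearI)
    (simp_all add: counit_linear scaleC_add_left scaleC_add_right scaleC_scaleC scaleC_complex_def mult.commute)

lemmas clinear_counit_fst = clinear_tensor_lift[OF cbilinear_counit_fst, folded counit_fst_def]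
lemmas counit_fst_simps = tensor_lift_tensor[OF cbilinear_counit_fst, folded counit_fst_def]
  clinear_add[OF clinear_counit_fst] clinear_scale[OF clinear_counit_fst]
lemmas counit_snd_simps = functional_snd_simps[OF linear_counit, folded counit_snd_def]

text \<open>The product \<open>m\<close> is left open because the slice takes values in
  \<open>H\<close> as well as in \<open>H \<otimes> H\<close>.\<close>

lemma counit_fst_mult:
  assumes "cbilinear m"
  shows "counit_fst (tensor_mult (*) m s t) = m (counit_fst s) (counit_fst t)"
proof -
  note [simp] = tensor_mult_tensor[OF cbilinear_mult assms]
    cbilinearD[OF cbilinear_tensor_mult[OF cbilinear_mult assms]] cbilinearD[OF assms]
    counit_fst_simps counit_mult scaleC_scaleC
  show ?thesis
  proof (induction s rule: tensor_induct)
    case (tensor x y)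
    show ?case
      by (induction t rule: tensor_induct) (simp_all add: scaleC_add_right mult.commute)
  qed simp
qed

lemma counit_fst_leg13: "counit_fst (leg13 1 t) = 1 \<otimes> counit_fst t"
  by (induction t rule: tensor_induct)
    (simp_all add: leg13_def tensor_lift_simps cbilinear_leg counit_fst_simps tensor_linear)

lemma counit_fst_comult: "counit_fst (\<Delta> x) = x"
  using counit_left by (simp add: counit_fst_def)

lemma counit_snd_comult: "counit_snd (\<Delta> x) = x"
  using counit_right by (simp add: counit_snd_def functional_snd_def)

lemma cbilinear_map_comult:
  "cbilinear (\<lambda>x y. \<Delta> x \<otimes> y)" "cbilinear (\<lambda>x y. x \<otimes> \<Delta> y)"
  by (rule cbilinearI, simp_all add: tensor_linear comult_linear)+

text \<open>By the counit law, \<open>\<epsilon> \<otimes> \<epsilon>\<close> composed with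
  \<open>\<Delta>\<close> is \<open>\<epsilon>\<close>.\<close>

lemma counit_fst_twice_comult: "counit_fst (counit_fst (tensor_assoc (tensor_map \<Delta> id t))) = counit_fst t"
proof (induction t rule: tensor_induct)
  case (tensor x z)
  \<comment> \<open>The coproduct of \<open>x\<close> is replaced by an arbitrary tensor
    \<open>d\<close>, which makes induction possible.\<close>
  have "counit_fst (counit_fst (tensor_assoc (d \<otimes> z))) = \<epsilon> (counit_fst d) *\<^sub>C z" for d
    by (induction d rule: tensor_induct)
      (simp_all add: tensor_assoc_tensor_tensor tensor_linear clinear_add[OF clinear_tensor_assoc]
        counit_fst_simps counit_linear scaleC_scaleC scaleC_complex_def scaleC_add_left)
  then show ?case
    by (simp add: tensor_map_def tensor_lift_simps cbilinear_map_comult counit_fst_comult counit_fst_simps)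
next
  case (add s t)
  then show ?case
    by (simp add: tensor_map_def tensor_lift_simps cbilinear_map_comult
        clinear_add[OF clinear_tensor_assoc] counit_fst_simps)
qed

lemma counit_snd_twice_comult:
  "functional_snd (\<lambda>w. \<epsilon> (counit_fst w)) (tensor_map id \<Delta> t) = counit_snd t"
  by (induction t rule: tensor_induct)
    (simp_all add: tensor_map_def tensor_lift_simps cbilinear_map_comult counit_fst_comult
      functional_snd_simps[OF clinear_compose[OF linear_counit clinear_counit_fst]] counit_snd_simps)

end

section \<open>Counit slices of the R-matrix and of its inverse\<close>

context quasitriangular_bialgebra
begin

lemma mult2_tensor_inverse:
  "mult2 R (tensor_inverse R) = 1 \<otimes> 1" "mult2 (tensor_inverse R) R = 1 \<otimes> 1"
  using R_invertible tensor_inverse_eq by metis+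

text \<open>Both counits of \<open>R\<close> are idempotent, by the coproduct axioms, and invertible.\<close>

lemma counit_fst_inverse: "counit_fst (tensor_inverse R) = 1"
proof -
  \<comment> \<open>Apply \<open>\<epsilon> \<otimes> \<epsilon> \<otimes> id\<close> to the axiom
    for the coproduct on the first leg: each of the two factors on the right slices to
    \<open>counit_fst R\<close>.\<close>
  have "counit_fst R = counit_fst (counit_fst (mult3 (leg13 1 R) (leg23 1 R)))"
    by (simp add: comult_id_R[symmetric] counit_fst_twice_comult)
  also have "\<dots> = counit_fst R * counit_fst R"
    by (simp add: counit_fst_mult cbilinear_mult cbilinear_mult2 counit_fst_leg13 leg23_def
        counit_fst_simps counit_one scaleC_one)
  finally have idem: "counit_fst R * counit_fst R = counit_fst R" by simp
  have inv: "counit_fst (tensor_inverse R) * counit_fst R = 1"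
    using arg_cong[OF mult2_tensor_inverse(2), of counit_fst]
    by (simp add: counit_fst_mult cbilinear_mult counit_fst_simps counit_one scaleC_one)
  \<comment> \<open>An idempotent with a left inverse is 1; \<open>inv\<close> then makes the left
    inverse 1 too.\<close>
  then have "counit_fst R = 1"
    using idem by (metis mult.assoc mult_1_left)
  then show ?thesis
    using inv by simp
qed

lemma counit_snd_inverse: "counit_snd (tensor_inverse R) = 1"
proof -
  \<comment> \<open>This is \<open>\<epsilon> \<otimes> \<epsilon>\<close> on the last two legs; it
    sends both \<open>leg12\<close> and \<open>leg13\<close> of a tensor to its
    \<open>counit_snd\<close>.\<close>
  let ?\<chi> = "\<lambda>w. \<epsilon> (counit_fst w)"
  have lin: "clinear ?\<chi>"
    by (rule clinear_compose[OF linear_counit clinear_counit_fst])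
  have leg12: "functional_snd ?\<chi> (leg12 1 t) = counit_snd t" for t :: "('h, 'h) tensor"
    by (induction t rule: tensor_induct)
      (simp_all add: leg12_def tensor_lift_simps cbilinear_leg functional_snd_simps[OF lin]
        counit_fst_simps counit_snd_simps counit_linear counit_one scaleC_complex_def)
  have leg13: "functional_snd ?\<chi> (leg13 1 t) = counit_snd t" for t :: "('h, 'h) tensor"
    by (induction t rule: tensor_induct)
      (simp_all add: leg13_def tensor_lift_simps cbilinear_leg functional_snd_simps[OF lin]
        counit_fst_simps counit_snd_simps counit_one scaleC_one)
  have "counit_snd R = functional_snd ?\<chi> (mult3 (leg13 1 R) (leg12 1 R))"
    by (simp add: id_comult_R[symmetric] counit_snd_twice_comult)
  also have "\<dots> = counit_snd R * counit_snd R"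
    by (simp add: functional_snd_mult[OF lin] counit_fst_mult counit_mult cbilinear_mult
        cbilinear_mult2 leg12 leg13)
  finally have idem: "counit_snd R * counit_snd R = counit_snd R" by simp
  have inv: "counit_snd (tensor_inverse R) * counit_snd R = 1"
    using arg_cong[OF mult2_tensor_inverse(2), of counit_snd]
    by (simp add: counit_snd_def functional_snd_mult[OF linear_counit] cbilinear_mult
        functional_snd_simps[OF linear_counit] counit_mult counit_one scaleC_one)
  then have "counit_snd R = 1"
    using idem by (metis mult.assoc mult_1_left)
  then show ?thesis
    using inv by simp
qed

end

section \<open>The RE dual\<close>

locale quasitriangular_involution =
  quasitriangular_bialgebra \<Delta> \<epsilon> R + bialgebra_involution \<Delta> \<epsilon> \<tau>
  for \<Delta> :: "'h::complex_algebra_1 \<Rightarrow> ('h, 'h) tensor" and \<epsilon> R \<tau>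
begin

lemmas inv_linear = clinear_add[OF linear_inv] clinear_scale[OF linear_inv]

lemma cbilinear_pairing_mult: "cbilinear (\<lambda>y z. pairing a y * pairing b z)"
  by (rule cbilinearI) (simp_all add: pairing_linear scaleC_complex_def algebra_simps)

lemma cbilinear_dual_mult: "cbilinear (dual_mult \<Delta>)"
proof -
  \<comment> \<open>A fixed tensor \<open>t\<close> replaces the coproduct of \<open>x\<close>, so
    that bilinearity in \<open>a\<close> and \<open>b\<close> is a statement about one lift.\<close>
  define P where "P t a b = tensor_lift (\<lambda>y z. pairing a y * pairing b z) t"
    for t :: "('h, 'h) tensor" and a b :: "'h dual"
  have "cbilinear (P t)" for t
    unfolding P_def by (rule cbilinear_tensor_lift_param; rule cbilinearI)
      (simp_all add: pairing_linear scaleC_complex_def algebra_simps)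
  moreover have "pairing (dual_mult \<Delta> a b) x = P (\<Delta> x) a b" for a b x
    by (simp add: P_def pairing_dual_mult[OF linear_comult])
  ultimately show ?thesis
    by (intro cbilinearI dual_eqI)
      (simp_all add: plus_dual.rep_eq scaleC_dual.rep_eq cbilinearD scaleC_complex_def)
qed

lemma act_linear:
  "act_left (u + u') a = act_left u a + act_left u' a" "act_left (c *\<^sub>C u) a = c *\<^sub>C act_left u a"
  "act_left u (a + a') = act_left u a + act_left u a'" "act_left u (c *\<^sub>C a) = c *\<^sub>C act_left u a"
  "act_right a (u + u') = act_right a u + act_right a u'" "act_right a (c *\<^sub>C u) = c *\<^sub>C act_right a u"
  "act_right (a + a') u = act_right a u + act_right a' u" "act_right (c *\<^sub>C a) u = c *\<^sub>C act_right a u"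
  for a a' :: "'h dual"
  by (rule dual_eqI; simp add: act_left.rep_eq act_right.rep_eq pairing_linear algebra_simps
      mult_scaleC_left mult_scaleC_right scaleC_complex_def)+

lemma cbilinear_RE_integrand:
  "cbilinear (\<lambda>u v. dual_mult \<Delta> (act_left (\<tau> u) a) (act_right b v))"
  by (rule cbilinearI) (simp_all add: cbilinearD[OF cbilinear_dual_mult] act_linear inv_linear)

lemma cbilinear_RE_mult: "cbilinear (RE_mult \<Delta> R \<tau>)"
proof -
  have "cbilinear (\<lambda>a b. dual_mult \<Delta> (act_left (\<tau> u) a) (act_right b v))" for u v
    by (rule cbilinearI) (simp_all add: cbilinearD[OF cbilinear_dual_mult] act_linear)
  then have "cbilinear (\<lambda>a b. RE_mult \<Delta> R \<tau> a b)"
    unfolding RE_mult_def by (intro cbilinear_tensor_lift_param cbilinear_RE_integrand)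
  then show ?thesis
    by simp
qed

text \<open>The left action multiplies the argument on the right and the right action on the left,
  so the components of the inverse land between the two coproduct components.\<close>

lemma pairing_RE_mult:
  assumes Q: "tensor_inverse R = (\<Sum>j\<in>J. p j \<otimes> q j)" and y: "\<Delta> y = (\<Sum>k\<in>K. c k \<otimes> d k)"
  shows "pairing (RE_mult \<Delta> R \<tau> a b) y
    = (\<Sum>j\<in>J. \<Sum>k\<in>K. pairing a (c k * \<tau> (p j)) * pairing b (q j * d k))"
proof -
  have "pairing (RE_mult \<Delta> R \<tau> a b) y
      = (\<Sum>j\<in>J. \<Sum>k\<in>K. pairing (act_left (\<tau> (p j)) a) (c k) * pairing (act_right b (q j)) (d k))"
    by (simp add: RE_mult_def Q y tensor_lift_sum cbilinear_RE_integrand pairing_sum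
        pairing_dual_mult[OF linear_comult] cbilinear_pairing_mult)
  then show ?thesis
    by (simp add: act_left.rep_eq act_right.rep_eq)
qed

text \<open>Since \<open>\<epsilon>\<close> is multiplicative and invariant under
  \<open>\<tau>\<close>, the double sum factors into the counit slice of the inverse of R, which is
  1, and that of the coproduct of \<open>y\<close>, which is \<open>y\<close>.\<close>

lemma RE_mult_one_left: "RE_mult \<Delta> R \<tau> (RE_one \<epsilon>) b = b"
proof (rule dual_eqI)
  fix y
  obtain J :: "('h \<times> 'h) set" and p q where Q: "tensor_inverse R = (\<Sum>j\<in>J. p j \<otimes> q j)"
    by (rule tensor_sum_rep)
  obtain K :: "('h \<times> 'h) set" and c d where y: "\<Delta> y = (\<Sum>k\<in>K. c k \<otimes> d k)"
    by (rule tensor_sum_rep)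
  have q: "(\<Sum>j\<in>J. \<epsilon> (p j) *\<^sub>C q j) = 1"
    using counit_fst_inverse by (simp add: Q counit_fst_def tensor_lift_sum cbilinear_counit_fst)
  have d: "(\<Sum>k\<in>K. \<epsilon> (c k) *\<^sub>C d k) = y"
    using counit_fst_comult[of y] by (simp add: y counit_fst_def tensor_lift_sum cbilinear_counit_fst)
  have "pairing b ((\<Sum>j\<in>J. \<epsilon> (p j) *\<^sub>C q j) * (\<Sum>k\<in>K. \<epsilon> (c k) *\<^sub>C d k))
      = pairing (RE_mult \<Delta> R \<tau> (RE_one \<epsilon>) b) y"
    by (simp add: pairing_RE_mult[OF Q y] sum_product complex_vector.linear_sum[OF clinear_pairing]
        pairing_linear mult_scaleC_left mult_scaleC_right scaleC_complex_def
        pairing_RE_one[OF linear_counit] counit_mult counit_inv mult_ac)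
  then show "pairing (RE_mult \<Delta> R \<tau> (RE_one \<epsilon>) b) y = pairing b y"
    by (simp add: q d)
qed

text \<open>The same factorization with the second legs sliced; here \<open>\<tau>\<close> is
  applied to the slice of the inverse, hence \<open>inv_one\<close>.\<close>

lemma RE_mult_one_right: "RE_mult \<Delta> R \<tau> a (RE_one \<epsilon>) = a"
proof (rule dual_eqI)
  fix y
  obtain J :: "('h \<times> 'h) set" and p q where Q: "tensor_inverse R = (\<Sum>j\<in>J. p j \<otimes> q j)"
    by (rule tensor_sum_rep)
  obtain K :: "('h \<times> 'h) set" and c d where y: "\<Delta> y = (\<Sum>k\<in>K. c k \<otimes> d k)"
    by (rule tensor_sum_rep)
  note functional = counit_snd_def complex_vector.linear_sum[OF clinear_functional_snd[OF linear_counit]]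
    functional_snd_simps[OF linear_counit]
  have p: "(\<Sum>j\<in>J. \<epsilon> (q j) *\<^sub>C p j) = 1"
    using counit_snd_inverse by (simp add: Q functional)
  have c: "(\<Sum>k\<in>K. \<epsilon> (d k) *\<^sub>C c k) = y"
    using counit_snd_comult[of y] by (simp add: y functional)
  have "pairing a ((\<Sum>k\<in>K. \<epsilon> (d k) *\<^sub>C c k) * \<tau> (\<Sum>j\<in>J. \<epsilon> (q j) *\<^sub>C p j))
      = (\<Sum>k\<in>K. \<Sum>j\<in>J. pairing a (c k * \<tau> (p j)) * (\<epsilon> (q j) * \<epsilon> (d k)))"
    by (simp add: sum_product complex_vector.linear_sum[OF clinear_pairing]
        complex_vector.linear_sum[OF linear_inv] inv_linear
        pairing_linear mult_scaleC_left mult_scaleC_right scaleC_complex_def mult_ac)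
  also have "\<dots> = pairing (RE_mult \<Delta> R \<tau> a (RE_one \<epsilon>)) y"
    by (subst sum.swap) (simp add: pairing_RE_mult[OF Q y] pairing_RE_one[OF linear_counit] counit_mult)
  finally show "pairing (RE_mult \<Delta> R \<tau> a (RE_one \<epsilon>)) y = pairing a y"
    by (simp add: p c inv_one)
qed

section \<open>Products and coactions in terms of maps on \<open>H\<close>\<close>

lemmas cbilinear_mult_HD = cbilinear_tensor_mult[OF cbilinear_mult cbilinear_RE_mult]
lemmas mult_HD_tensor = tensor_mult_tensor[OF cbilinear_mult cbilinear_RE_mult]
lemmas mult_HD_linear = cbilinearD[OF cbilinear_mult_HD]
lemmas mult_HHD_linear = cbilinearD[OF cbilinear_tensor_mult[OF cbilinear_mult cbilinear_mult_HD]]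
lemmas mult_HHD_tensor = tensor_mult_tensor[OF cbilinear_mult cbilinear_mult_HD]

text \<open>Under evaluation the product of \<open>H \<otimes> H*\<close> becomes convolution of
  maps from \<open>H\<close> to \<open>H\<close>, twisted by the inverse of R.\<close>

lemma eval_dual_mult_HD:
  assumes Q: "tensor_inverse R = (\<Sum>j\<in>J. p j \<otimes> q j)" and y: "\<Delta> y = (\<Sum>k\<in>K. c k \<otimes> d k)"
  shows "eval_dual y (mult_HD \<Delta> R \<tau> s t)
    = (\<Sum>j\<in>J. \<Sum>k\<in>K. eval_dual (c k * \<tau> (p j)) s * eval_dual (q j * d k) t)"
proof (induction s rule: tensor_induct)
  case (tensor h a)
  show ?case
  proof (induction t rule: tensor_induct)
    case (tensor g b)
    show ?case
      by (simp add: mult_HD_tensor eval_dual_simps pairing_RE_mult[OF Q y] mult_scaleC_left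
          mult_scaleC_right scaleC_scaleC complex_vector.scale_sum_left mult.commute)
  qed (simp add: mult_HD_linear eval_dual_simps algebra_simps sum.distrib)
qed (simp add: mult_HD_linear eval_dual_simps algebra_simps sum.distrib)

text \<open>Contracting the first leg of the defining equation with \<open>a\<close> isolates
  \<open>\<delta> a\<close>. The RE unit is neutral, so the third leg is that of the S-matrix, which
  evaluates at \<open>z\<close> to \<open>z\<close>. Leaving \<open>X\<close> and \<open>Y\<close>
  general covers both coactions.\<close>

lemma coaction_formula:
  assumes B: "finite B" "is_basis B" and \<delta>: "clinear \<delta>"
    and X: "X = (\<Sum>i\<in>I. x i \<otimes> y i)" and Y: "Y = (\<Sum>j\<in>J. p j \<otimes> q j)"
    and eq: "tensor_map id \<delta> (S_matrix B) =
      mult_HHD \<Delta> R \<tau> (mult_HHD \<Delta> R \<tau> (leg12 (RE_one \<epsilon>) X) (leg13 1 (S_matrix B)))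
        (leg12 (RE_one \<epsilon>) Y)"
  shows "eval_dual z (\<delta> a) = (\<Sum>i\<in>I. \<Sum>j\<in>J. pairing a (x i * z * p j) *\<^sub>C (y i * q j))"
proof -
  \<comment> \<open>The S-matrix is generalized to any \<open>t\<close> for the induction;
    \<open>eval_dual_S_matrix\<close> later turns \<open>eval_dual z t\<close> into
    \<open>z\<close>.\<close>
  have summand: "eval_dual z (eval_fst a (mult_HHD \<Delta> R \<tau> (mult_HHD \<Delta> R \<tau> (x \<otimes> (y \<otimes> RE_one \<epsilon>)) (leg13 1 t))
        (p \<otimes> (q \<otimes> RE_one \<epsilon>)))) = pairing a (x * eval_dual z t * p) *\<^sub>C (y * q)"
    for x y p q and t :: "('h, 'h dual) tensor"
    by (induction t rule: tensor_induct)
      (simp_all add: leg13_def tensor_lift_simps cbilinear_leg mult_HHD_tensor mult_HD_tensor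
        RE_mult_one_left RE_mult_one_right eval_fst_simps eval_dual_simps mult_HHD_linear
        mult_scaleC_left mult_scaleC_right pairing_linear scaleC_scaleC scaleC_complex_def
        algebra_simps scaleC_add_left)
  have lin: "clinear (\<lambda>s. mult_HHD \<Delta> R \<tau> (mult_HHD \<Delta> R \<tau> s u) v)" "clinear (\<lambda>t. mult_HHD \<Delta> R \<tau> s t)"
    for s u v
    by (rule clinearI, simp_all add: mult_HHD_linear)+
  have "\<delta> a = eval_fst a (tensor_map id \<delta> (S_matrix B))"
    by (simp add: eval_fst_tensor_map[OF \<delta>] eval_fst_S_matrix[OF B])
  then have "eval_dual z (\<delta> a) = (\<Sum>j\<in>J. \<Sum>i\<in>I. pairing a (x i * z * p j) *\<^sub>C (y i * q j))"
    unfolding eq X Y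
    by (simp add: leg12_def tensor_lift_sum cbilinear_leg complex_vector.linear_sum[OF lin(1)]
        complex_vector.linear_sum[OF lin(2)] complex_vector.linear_sum[OF clinear_eval_fst]
        complex_vector.linear_sum[OF clinear_eval_dual] summand eval_dual_S_matrix[OF B])
  then show ?thesis
    by (subst sum.swap) simp
qed

end

section \<open>The intertwining identity\<close>

lemma sum_rotate4:
  "(\<Sum>j\<in>J. \<Sum>k\<in>K. \<Sum>i\<in>I. \<Sum>l\<in>L. g j k i l) = (\<Sum>i\<in>I. \<Sum>k\<in>K. \<Sum>l\<in>L. \<Sum>j\<in>J. g j k i l)"
proof -
  have "(\<Sum>j\<in>J. \<Sum>k\<in>K. \<Sum>i\<in>I. \<Sum>l\<in>L. g j k i l) = (\<Sum>k\<in>K. \<Sum>j\<in>J. \<Sum>i\<in>I. \<Sum>l\<in>L. g j k i l)"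
    by (rule sum.swap)
  also have "\<dots> = (\<Sum>k\<in>K. \<Sum>i\<in>I. \<Sum>j\<in>J. \<Sum>l\<in>L. g j k i l)"
    by (intro sum.cong refl sum.swap)
  also have "\<dots> = (\<Sum>k\<in>K. \<Sum>i\<in>I. \<Sum>l\<in>L. \<Sum>j\<in>J. g j k i l)"
    by (intro sum.cong refl sum.swap)
  also have "\<dots> = (\<Sum>i\<in>I. \<Sum>k\<in>K. \<Sum>l\<in>L. \<Sum>j\<in>J. g j k i l)"
    by (rule sum.swap)
  finally show ?thesis .
qed

theorem theorem11:
  fixes \<Delta> :: "'h::complex_algebra_1 \<Rightarrow> ('h, 'h) tensor"
    and \<epsilon> :: "'h \<Rightarrow> complex"
    and R :: "('h, 'h) tensor"
    and \<tau> :: "'h \<Rightarrow> 'h"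
    and B :: "'h set"
    and \<delta> \<delta>' :: "'h dual \<Rightarrow> ('h, 'h dual) tensor"
    and a :: "'h dual"
  assumes "quasitriangular_bialgebra \<Delta> \<epsilon> R"
    and "bialgebra_involution \<Delta> \<epsilon> \<tau>"
    and "finite B" and "is_basis B"
    and "clinear \<delta>"
    and "tensor_map id \<delta> (S_matrix B) =
      mult_HHD \<Delta> R \<tau>
        (mult_HHD \<Delta> R \<tau> (leg12 (RE_one \<epsilon>) R) (leg13 1 (S_matrix B)))
        (leg12 (RE_one \<epsilon>) (R_prime \<tau> R))"
    and "clinear \<delta>'"
    and "tensor_map id \<delta>' (S_matrix B) =
      mult_HHD \<Delta> R \<tau>
        (mult_HHD \<Delta> R \<tau> (leg12 (RE_one \<epsilon>) (R_dprime \<tau> R)) (leg13 1 (S_matrix B)))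
        (leg12 (RE_one \<epsilon>) R)"
  shows "mult_HD \<Delta> R \<tau> (\<delta> a) (S_matrix B) = mult_HD \<Delta> R \<tau> (S_matrix B) (\<delta>' a)"
proof (rule eval_dual_ext[OF assms(3,4)])
  interpret quasitriangular_involution \<Delta> \<epsilon> R \<tau>
    using assms(1,2) by (rule quasitriangular_involution.intro)
  fix y
  obtain I :: "('h \<times> 'h) set" and r s where R: "R = (\<Sum>i\<in>I. r i \<otimes> s i)"
    by (rule tensor_sum_rep)
  obtain J :: "('h \<times> 'h) set" and p q where Q: "tensor_inverse R = (\<Sum>j\<in>J. p j \<otimes> q j)"
    by (rule tensor_sum_rep)
  obtain K :: "('h \<times> 'h) set" and c d where y: "\<Delta> y = (\<Sum>k\<in>K. c k \<otimes> d k)"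
    by (rule tensor_sum_rep)
  have "cbilinear (\<lambda>x (y :: 'h). \<tau> x \<otimes> y)" "cbilinear (\<lambda>x (y :: 'h). y \<otimes> \<tau> x)"
    "cbilinear (\<lambda>(x :: 'h) (y :: 'h). y \<otimes> x)"
    by (rule cbilinearI, simp_all add: tensor_linear inv_linear)+
  then have R': "R_prime \<tau> R = (\<Sum>i\<in>I. \<tau> (r i) \<otimes> s i)"
    and R'': "R_dprime \<tau> R = (\<Sum>i\<in>I. s i \<otimes> \<tau> (r i))"
    and flip: "tensor_flip (\<Delta> y) = (\<Sum>k\<in>K. d k \<otimes> c k)"
    by (simp_all add: R y R_prime_def R_dprime_def tensor_flip_def tensor_lift_sum)
  have \<delta>: "eval_dual z (\<delta> a) = (\<Sum>i\<in>I. \<Sum>i'\<in>I. pairing a (r i * z * \<tau> (r i')) *\<^sub>C (s i * s i'))" for z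
    by (rule coaction_formula[OF assms(3,4,5) R R' assms(6)])
  have \<delta>': "eval_dual z (\<delta>' a) = (\<Sum>i\<in>I. \<Sum>i'\<in>I. pairing a (s i * z * r i') *\<^sub>C (\<tau> (r i) * s i'))" for z
    by (rule coaction_formula[OF assms(3,4,7) R'' R assms(8)])
  have RQ: "mult2 (\<Sum>i\<in>I. r i \<otimes> s i) (\<Sum>j\<in>J. p j \<otimes> q j) = 1 \<otimes> 1"
    using mult2_tensor_inverse(1) unfolding Q R[symmetric] .
  \<comment> \<open>As \<open>\<tau>\<close> reverses products,
    \<open>\<tau> (p j) * \<tau> (r l)\<close> from the twist and from \<open>R_prime\<close> is
    \<open>\<tau> (r l * p j)\<close>. It is matched by \<open>s l * q j\<close> in the other
    factor, so the product of R with its inverse appears.\<close>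
  have cancel_left: "(\<Sum>l\<in>I. \<Sum>j\<in>J. pairing a (x * \<tau> (r l * p j)) *\<^sub>C (w * (s l * q j) * z))
      = pairing a x *\<^sub>C (w * z)" for x w z
  proof -
    have "cbilinear (\<lambda>u v. pairing a (x * \<tau> u) *\<^sub>C (w * v * z))"
      by (rule cbilinearI)
        (simp_all add: inv_linear pairing_linear algebra_simps mult_scaleC_left mult_scaleC_right
          scaleC_complex_def scaleC_scaleC scaleC_add_left scaleC_add_right)
    from mult2_one_sum[OF RQ this] show ?thesis
      by (simp add: inv_one)
  qed
  \<comment> \<open>The same mechanism for \<open>R_dprime\<close>, whose legs are flipped: the
    \<open>\<tau>\<close> part now lies in \<open>H\<close> and \<open>s l * q j\<close> in the
    pairing.\<close>
  have cancel_right: "(\<Sum>l\<in>I. \<Sum>j\<in>J. pairing a (s l * q j * x) *\<^sub>C (w * \<tau> (r l * p j) * z))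
      = pairing a x *\<^sub>C (w * z)" for x w z
  proof -
    have "cbilinear (\<lambda>u v. pairing a (v * x) *\<^sub>C (w * \<tau> u * z))"
      by (rule cbilinearI)
        (simp_all add: inv_linear pairing_linear algebra_simps mult_scaleC_left mult_scaleC_right
          scaleC_complex_def scaleC_scaleC scaleC_add_left scaleC_add_right)
    from mult2_one_sum[OF RQ this] show ?thesis
      by (simp add: inv_one)
  qed
  note product = tensor_mult_sum[OF cbilinear_mult cbilinear_mult]
    complex_vector.linear_sum[OF clinear_eval_fst] eval_fst_simps
  have "eval_dual y (mult_HD \<Delta> R \<tau> (\<delta> a) (S_matrix B))
      = (\<Sum>j\<in>J. \<Sum>k\<in>K. \<Sum>i\<in>I. \<Sum>l\<in>I.
          pairing a (r i * c k * \<tau> (r l * p j)) *\<^sub>C (s i * (s l * q j) * d k))"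
    by (simp add: eval_dual_mult_HD[OF Q y] eval_dual_S_matrix[OF assms(3,4)] \<delta> sum_distrib_right
        mult_scaleC_left inv_mult mult.assoc)
  \<comment> \<open>After rotation the sums over \<open>l\<close> and \<open>j\<close> are innermost
    and cancel, which leaves R times the coproduct of \<open>y\<close>, contracted with
    \<open>a\<close>.\<close>
  also have "\<dots> = eval_fst a (mult2 (\<Sum>i\<in>I. r i \<otimes> s i) (\<Sum>k\<in>K. c k \<otimes> d k))"
    by (simp only: sum_rotate4[where J = J] cancel_left product)
  also have "\<dots> = eval_fst a (mult2 (\<Sum>k\<in>K. d k \<otimes> c k) (\<Sum>i\<in>I. r i \<otimes> s i))"
    unfolding R[symmetric] y[symmetric] flip[symmetric] by (simp only: R_comult)
  also have "\<dots> = (\<Sum>i\<in>I. \<Sum>k\<in>K. pairing a (d k * r i) *\<^sub>C (c k * s i))"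
    unfolding product by (rule sum.swap)
  \<comment> \<open>Here \<open>cancel_right\<close> is used backwards, to insert R and its
    inverse.\<close>
  also have "\<dots> = (\<Sum>j\<in>J. \<Sum>k\<in>K. \<Sum>i\<in>I. \<Sum>l\<in>I.
      pairing a (s l * q j * (d k * r i)) *\<^sub>C (c k * \<tau> (r l * p j) * s i))"
    by (simp only: sum_rotate4[where J = J] cancel_right)
  \<comment> \<open>The formula for \<open>\<delta>'\<close> sums first over the copy of R in
    \<open>R_dprime\<close>, here indexed by \<open>l\<close>.\<close>
  also have "\<dots> = (\<Sum>j\<in>J. \<Sum>k\<in>K. \<Sum>l\<in>I. \<Sum>i\<in>I.
      pairing a (s l * q j * (d k * r i)) *\<^sub>C (c k * \<tau> (r l * p j) * s i))"
    by (intro sum.cong refl sum.swap)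
  also have "\<dots> = eval_dual y (mult_HD \<Delta> R \<tau> (S_matrix B) (\<delta>' a))"
    by (simp add: eval_dual_mult_HD[OF Q y] eval_dual_S_matrix[OF assms(3,4)] \<delta>' sum_distrib_left
        mult_scaleC_right inv_mult mult.assoc)
  finally show "eval_dual y (mult_HD \<Delta> R \<tau> (\<delta> a) (S_matrix B))
      = eval_dual y (mult_HD \<Delta> R \<tau> (S_matrix B) (\<delta>' a))" .
qed

end
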